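(* Let $T=\begin{pmatrix}A&B\\C&D\end{pmatrix}\in\psi(M,N)$. If $\mathcal{R}(C)$ is infinite-dimensional, then $T\in\partial\big((\psi(M,N))^{\complement}\big)$, where the boundary is taken with respect to the strong operator topology on $\mathcal{B}(\mathcal{H},\mathcal{K})$.
   Context: $\mathcal{H}$ and $\mathcal{K}$ are real or complex Hilbert spaces, $\mathcal{B}(\mathcal{H},\mathcal{K})$ is the space of bounded linear operators from $\mathcal{H}$ to $\mathcal{K}$, and $\mathcal{B}(\mathcal{H})=\mathcal{B}(\mathcal{H},\mathcal{H})$. $\mathcal{R}(\cdot)$ denotes range and $*$ denotes adjoint. $M\subseteq\mathcal{H}$ and $N\subseteq\mathcal{K}$ are closed subspaces. Block matrices are taken with respect to $\mathcal{H}=M\oplus M^\perp$ and $\mathcal{K}=N\oplus N^\perp$, so $A:M\to N$, $B:M^\perp\to N$, $C:M\to N^\perp$, $D:M^\perp\to N^\perp$. $T\in\mathcal{B}(\mathcal{H},\mathcal{K})$ is $(M,N)$-complementable if there are (bounded, idempotent) projections $P_r\in\mathcal{B}(\mathcal{H})$, $P_\ell\in\mathcal{B}(\mathcal{K})$ with ranges $M$ and $N$ respectively, and operators $M_r\in\mathcal{B}(\mathcal{H})$, $M_\ell\in\mathcal{B}(\mathcal{K})$ with $(I-P_r)M_r=M_r$, $(I-P_\ell)TM_r=(I-P_\ell)T$, $M_\ell(I-P_\ell)=M_\ell$, $M_\ell T(I-P_r)=T(I-P_r)$. It is known that this is equivalent to $\mathcal{R}(C)\subseteq\mathcal{R}(D)$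 and $\mathcal{R}(B^* )\subseteq\mathcal{R}(D^* )$. $\psi(M,N)$ is the set of all $(M,N)$-complementable operators and $(\psi(M,N))^{\complement}$ is its complement in $\mathcal{B}(\mathcal{H},\mathcal{K})$, i.e. the set of operators that are not $(M,N)$-complementable. $\partial$ denotes topological boundary.
   Formalization: The projections P_r and P_ℓ in the definition of complementability are taken to be orthogonal; with arbitrary bounded idempotents the stated equivalence with the range conditions fails, and so does the theorem (N=0, M and K separable infinite-dimensional, M^⊥ nonseparable). *)

theory Defs
  imports "HOL-Analysis.Analysis"
begin

text \<open>
  Scalars. Every element of a field in this class is a root of the real quadratic
  \<open>X\<^sup>2 - (x + scalar_cnj x) X + (norm x)\<^sup>2\<close>, so up to isomorphism the only instances are
  the reals with the identity and the complex numbers with complex conjugation. The class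
  makes it possible to treat real and complex Hilbert spaces at once.
\<close>

class real_or_complex = real_normed_field +
  fixes scalar_cnj :: "'a \<Rightarrow> 'a"
  assumes scalar_cnj_add: "scalar_cnj (x + y) = scalar_cnj x + scalar_cnj y"
    and scalar_cnj_mult: "scalar_cnj (x * y) = scalar_cnj x * scalar_cnj y"
    and mult_scalar_cnj: "x * scalar_cnj x = ((norm x)\<^sup>2) *\<^sub>R 1"

instantiation real :: real_or_complex
begin
definition scalar_cnj_real :: "real \<Rightarrow> real" where "scalar_cnj_real x = x"
instance by standard (auto simp: scalar_cnj_real_def power2_eq_square)
end

instantiation complex :: real_or_complex
begin
definition scalar_cnj_complex :: "complex \<Rightarrow> complex" where "scalar_cnj_complex = cnj"
instance
proof
  show "x * scalar_cnj x = ((norm x)\<^sup>2) *\<^sub>R 1" for x :: complex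
    unfolding scalar_cnj_complex_def scaleR_conv_of_real
    by (metis complex_norm_square mult.right_neutral)
qed (simp_all add: scalar_cnj_complex_def)
end

text \<open>
  The topology and completeness are those of the Banach space type \<open>'a\<close>; the last axiom says
  that its norm is the one induced by the inner product (which is linear in the first
  argument), and so includes positive definiteness.
\<close>

locale hilbert_space = vector_space smul
  for smul :: "'k::real_or_complex \<Rightarrow> 'a::banach \<Rightarrow> 'a" +
  fixes ip :: "'a \<Rightarrow> 'a \<Rightarrow> 'k"
  assumes scale_of_real: "smul (of_real r) x = r *\<^sub>R x"
    and ip_add_left: "ip (x + y) z = ip x z + ip y z"
    and ip_scale_left: "ip (smul c x) y = c * ip x y"
    and ip_commute: "ip y x = scalar_cnj (ip x y)"
    and ip_self: "ip x x = of_real ((norm x)\<^sup>2)"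

lemma hilbert_space_real:
  "hilbert_space (scaleR :: real \<Rightarrow> 'a \<Rightarrow> 'a::{real_inner, banach}) inner"
  by unfold_locales
    (simp_all add: scaleR_add_right scaleR_add_left inner_add_left inner_add_right scalar_cnj_real_def
      dot_square_norm inner_commute)

lemma hilbert_space_complex:
  "hilbert_space ((*) :: complex \<Rightarrow> complex \<Rightarrow> complex) (\<lambda>x y. x * cnj y)"
proof unfold_locales
  show "x * cnj x = of_real ((norm x)\<^sup>2)" for x :: complex
    using complex_norm_square [of x] by simp
qed (simp_all add: distrib_left distrib_right mult.assoc mult.commute scalar_cnj_complex_def
    scaleR_conv_of_real)

definition orth_complement :: "('a \<Rightarrow> 'a \<Rightarrow> 'k::zero) \<Rightarrow> 'a set \<Rightarrow> 'a set" where
  "orth_complement ip M = {x. \<forall>m\<in>M. ip x m = 0}"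

definition orth_proj :: "('a::ab_group_add \<Rightarrow> 'a \<Rightarrow> 'k::zero) \<Rightarrow> 'a set \<Rightarrow> 'a \<Rightarrow> 'a" where
  "orth_proj ip M x = (THE p. p \<in> M \<and> x - p \<in> orth_complement ip M)"

definition closed_subspace :: "('k::field \<Rightarrow> 'a::banach \<Rightarrow> 'a) \<Rightarrow> 'a set \<Rightarrow> bool" where
  "closed_subspace smul M \<longleftrightarrow> module.subspace smul M \<and> closed M"

definition infinite_dimensional :: "('k::field \<Rightarrow> 'a::ab_group_add \<Rightarrow> 'a) \<Rightarrow> 'a set \<Rightarrow> bool" where
  "infinite_dimensional smul V \<longleftrightarrow> \<not> (\<exists>B. finite B \<and> V = module.span smul B)"

text \<open>
  \<open>'a \<Rightarrow>\<^sub>L 'b\<close> consists of the bounded real-linear maps; linearity over the scalar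
  field \<open>'k\<close> has to be imposed in addition.
\<close>

definition bounded_ops ::
  "('k \<Rightarrow> 'a::banach \<Rightarrow> 'a) \<Rightarrow> ('k \<Rightarrow> 'b::banach \<Rightarrow> 'b) \<Rightarrow> ('a \<Rightarrow>\<^sub>L 'b) set" where
  "bounded_ops scaleH scaleK =
    {T. \<forall>c x. blinfun_apply T (scaleH c x) = scaleK c (blinfun_apply T x)}"

definition sot_bounded_ops ::
  "('k \<Rightarrow> 'a::banach \<Rightarrow> 'a) \<Rightarrow> ('k \<Rightarrow> 'b::banach \<Rightarrow> 'b) \<Rightarrow> ('a \<Rightarrow>\<^sub>L 'b) topology" where
  "sot_bounded_ops scaleH scaleK =
    subtopology strong_operator_topology (bounded_ops scaleH scaleK)"

text \<open>
  The entry \<open>U \<rightarrow> V\<close> of the block matrix of \<open>T\<close>, where \<open>ip\<close> is the inner product of the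
  codomain of \<open>T\<close>.
\<close>

definition block ::
  "('b::banach \<Rightarrow> 'b \<Rightarrow> 'k::zero) \<Rightarrow> 'a::banach set \<Rightarrow> 'b set \<Rightarrow> ('a \<Rightarrow>\<^sub>L 'b) \<Rightarrow> 'a \<Rightarrow> 'b" where
  "block ip U V T = (\<lambda>x\<in>U. orth_proj ip V (blinfun_apply T x))"

definition orth_projection_onto ::
  "('k \<Rightarrow> 'a::banach \<Rightarrow> 'a) \<Rightarrow> ('a \<Rightarrow> 'a \<Rightarrow> 'k) \<Rightarrow> 'a set \<Rightarrow> ('a \<Rightarrow>\<^sub>L 'a) \<Rightarrow> bool" where
  "orth_projection_onto smul ip M P \<longleftrightarrow>
    P \<in> bounded_ops smul smul \<and> P o\<^sub>L P = P \<and> range (blinfun_apply P) = M \<and>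
    (\<forall>x y. ip (blinfun_apply P x) y = ip x (blinfun_apply P y))"

text \<open>
  The projections are orthogonal, matching the decompositions \<open>M \<oplus> M\<^sup>\<bottom>\<close> and
  \<open>N \<oplus> N\<^sup>\<bottom>\<close> used for the blocks. If arbitrary idempotents with ranges \<open>M\<close> and \<open>N\<close>
  were admitted, the notion would no longer be equivalent to \<open>R(C) \<subseteq> R(D)\<close> and
  \<open>R(B\<^sup>*) \<subseteq> R(D\<^sup>*)\<close>: take \<open>A = B = D = 0\<close>, \<open>C\<close> bijective and
  \<open>E : M\<^sup>\<bottom> \<rightarrow> M\<close> bijective; the idempotent \<open>m + m' \<mapsto> m - E m'\<close> onto \<open>M\<close>, the
  orthogonal projection onto \<open>N\<close>, \<open>M_r (m + m') = m + E\<^sup>-\<^sup>1 m\<close> and \<open>M_l = I - P_l\<close>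
  satisfy all four identities.
\<close>

definition complementable_ops ::
  "('k \<Rightarrow> 'a::banach \<Rightarrow> 'a) \<Rightarrow> ('a \<Rightarrow> 'a \<Rightarrow> 'k) \<Rightarrow>
   ('k \<Rightarrow> 'b::banach \<Rightarrow> 'b) \<Rightarrow> ('b \<Rightarrow> 'b \<Rightarrow> 'k) \<Rightarrow>
   'a set \<Rightarrow> 'b set \<Rightarrow> ('a \<Rightarrow>\<^sub>L 'b) set" where
  "complementable_ops scaleH ipH scaleK ipK M N =
    {T \<in> bounded_ops scaleH scaleK.
      \<exists>P\<^sub>r P\<^sub>l. \<exists>M\<^sub>r \<in> bounded_ops scaleH scaleH. \<exists>M\<^sub>l \<in> bounded_ops scaleK scaleK.
        orth_projection_onto scaleH ipH M P\<^sub>r \<and> orth_projection_onto scaleK ipK N P\<^sub>l \<and>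
        (id_blinfun - P\<^sub>r) o\<^sub>L M\<^sub>r = M\<^sub>r \<and>
        (id_blinfun - P\<^sub>l) o\<^sub>L T o\<^sub>L M\<^sub>r = (id_blinfun - P\<^sub>l) o\<^sub>L T \<and>
        M\<^sub>l o\<^sub>L (id_blinfun - P\<^sub>l) = M\<^sub>l \<and>
        M\<^sub>l o\<^sub>L T o\<^sub>L (id_blinfun - P\<^sub>r) = T o\<^sub>L (id_blinfun - P\<^sub>r)}"

end

theory Submission
  imports Defs
begin

text \<open>
  Since \<open>T\<close> is complementable, it only has to be approximated by operators that are not. A
  strong neighbourhood of \<open>T\<close> constrains operators at finitely many vectors only. Choosing a
  finite-rank \<open>Q\<close> that fixes the \<open>M\<^sup>\<bottom>\<close>-components of these vectors and setting
  \<open>S = T (P + Q (1 - P))\<close>, where \<open>P\<close> projects onto \<open>M\<close>, one gets an operator that agrees with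
  \<open>T\<close> at them and has the same block \<open>C\<close>, but whose block \<open>D\<close> has finite rank. So
  \<open>R(C) \<subseteq> R(D)\<close> fails for \<open>S\<close>.
\<close>

section \<open>Scalar-linear bounded operators and the strong operator topology\<close>

lemma bounded_ops_add:
  assumes "vector_space sK" "S \<in> bounded_ops sH sK" "T \<in> bounded_ops sH sK"
  shows "S + T \<in> bounded_ops sH sK"
  using assms
  by (simp add: bounded_ops_def blinfun.add_left module.scale_right_distrib flip: module_iff_vector_space)

lemma bounded_ops_diff:
  assumes "vector_space sK" "S \<in> bounded_ops sH sK" "T \<in> bounded_ops sH sK"
  shows "S - T \<in> bounded_ops sH sK"
  using assms
  by (simp add: bounded_ops_def blinfun.diff_left module.scale_right_diff_distrib flip: module_iff_vector_space)

lemma bounded_ops_compose: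
  assumes "S \<in> bounded_ops sK sL" "T \<in> bounded_ops sH sK"
  shows "S o\<^sub>L T \<in> bounded_ops sH sL"
  using assms by (simp add: bounded_ops_def)

lemma bounded_ops_id: "id_blinfun \<in> bounded_ops sH sH"
  by (simp add: bounded_ops_def)

lemma bounded_ops_zero: "vector_space sK \<Longrightarrow> 0 \<in> bounded_ops sH sK"
  by (simp add: bounded_ops_def module.scale_zero_right flip: module_iff_vector_space)

lemma bounded_ops_module_hom:
  assumes "vector_space sH" "vector_space sK" "T \<in> bounded_ops sH sK"
  shows "module_hom sH sK (blinfun_apply T)"
  using assms
  by (simp add: module_hom_iff bounded_ops_def blinfun.add_right module_iff_vector_space)

text \<open>This turns approximation into interpolation: the topology is pulled back from the
  product topology on functions, whose basic open sets restrict only finitely many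
  coordinates.\<close>

lemma openin_strong_operator_topology_finite:
  fixes T :: "'a::real_normed_vector \<Rightarrow>\<^sub>L 'b::real_normed_vector"
  assumes "openin strong_operator_topology U" "T \<in> U"
  obtains X where "finite X" "\<And>S. (\<And>x. x \<in> X \<Longrightarrow> blinfun_apply S x = blinfun_apply T x) \<Longrightarrow> S \<in> U"
proof -
  obtain V where V: "open V" "U = blinfun_apply -` V"
    using assms(1)
    unfolding strong_operator_topology_def openin_pullback_topology by auto
  have "openin (product_topology (\<lambda>i. euclidean) UNIV) V"
    using V(1) by (simp add: open_fun_def)
  moreover have "blinfun_apply T \<in> V"
    using assms(2) V(2) by simp
  ultimately obtain W where W: "blinfun_apply T \<in> Pi\<^sub>E UNIV W" "\<And>i. openin euclidean (W i)"
      "finite {i. W i \<noteq> topspace euclidean}" "Pi\<^sub>E UNIV W \<subseteq> V"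
    using product_topology_open_contains_basis[of "\<lambda>i. euclidean" UNIV V "blinfun_apply T"] by auto
  show thesis
  proof (rule that[OF W(3)])
    fix S assume S: "\<And>x. x \<in> {i. W i \<noteq> topspace euclidean} \<Longrightarrow> blinfun_apply S x = blinfun_apply T x"
    have "blinfun_apply S x \<in> W x" for x
      using W(1) S[of x] by (cases "W x = UNIV") (auto simp: PiE_iff)
    then show "S \<in> U"
      using W(4) V(2) by auto
  qed
qed

section \<open>Subspaces inside finite spans\<close>

context vector_space
begin

text \<open>\<open>infinite_dimensional\<close> only excludes finite sets whose span is exactly
  \<open>V\<close>. If \<open>V\<close> lay in a possibly larger finite span, the exchange lemma
  would make a basis of \<open>V\<close> finite, and that basis spans exactly
  \<open>V\<close>.\<close>

lemma infinite_dimensional_not_in_finite_span: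
  assumes "subspace V" "infinite_dimensional scale V" "finite X"
  shows "\<not> V \<subseteq> span X"
proof
  assume V: "V \<subseteq> span X"
  obtain B where B: "B \<subseteq> V" "independent B" "V \<subseteq> span B"
    using maximal_independent_subset[of V] by blast
  then have "finite B"
    using independent_span_bound[OF assms(3)] V by blast
  moreover have "V = span B"
    using B(1,3) span_minimal[OF B(1) assms(1)] by blast
  ultimately show False
    using assms(2) by (auto simp: infinite_dimensional_def)
qed

end

section \<open>Inner products and finite-rank operators\<close>

context hilbert_space
begin

lemma ip_add_right: "ip x (y + z) = ip x y + ip x z"
  by (metis ip_add_left ip_commute scalar_cnj_add)

lemma ip_diff_left: "ip (x - y) z = ip x z - ip y z"
  using ip_add_left[of "x - y" y z] by simp

lemma ip_diff_right: "ip x (y - z) = ip x y - ip x z"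
  using ip_add_right[of x "y - z" z] by simp

lemma ip_scale_right: "ip x (smul c y) = scalar_cnj c * ip x y"
  by (metis ip_commute ip_scale_left scalar_cnj_mult)

lemma ip_self_eq_0: "ip x x = 0 \<longleftrightarrow> x = 0"
  by (simp add: ip_self)

text \<open>Homogeneity for general scalars comes from the inner product, since
  \<open>c * scalar_cnj c\<close> is the square of \<open>norm c\<close>.\<close>

lemma norm_smul: "norm (smul c x) = norm c * norm x"
proof -
  have "(of_real ((norm (smul c x))\<^sup>2) :: 'k) = (c * scalar_cnj c) * of_real ((norm x)\<^sup>2)"
    by (simp only: ip_self[symmetric] ip_scale_left ip_scale_right mult.assoc mult.left_commute)
  also have "\<dots> = of_real ((norm c)\<^sup>2 * (norm x)\<^sup>2)"
    by (simp add: mult_scalar_cnj scaleR_conv_of_real)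
  finally have "(norm (smul c x))\<^sup>2 = (norm c * norm x)\<^sup>2"
    by (simp only: of_real_eq_iff power_mult_distrib)
  then show ?thesis
    by (simp add: power2_eq_iff_nonneg)
qed

text \<open>Bessel's inequality for one vector: the residual \<open>x - smul (ip x u) u\<close> has
  squared norm \<open>(norm x)\<^sup>2 - (norm (ip x u))\<^sup>2\<close>, which cannot be
  negative.\<close>

lemma norm_ip_unit_le:
  assumes "norm u = 1"
  shows "norm (ip x u) \<le> norm x"
proof -
  let ?c = "ip x u"
  have "of_real ((norm (x - smul ?c u))\<^sup>2) = ip x x - ?c * scalar_cnj ?c"
    using assms ip_self[of u]
    by (simp add: ip_self[symmetric] ip_diff_left ip_diff_right ip_scale_left ip_scale_right
        ip_commute[of u x] del: of_real_power)
  also have "\<dots> = of_real ((norm x)\<^sup>2 - (norm ?c)\<^sup>2)"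
    by (simp add: ip_self mult_scalar_cnj scaleR_conv_of_real)
  finally have "(norm (x - smul ?c u))\<^sup>2 = (norm x)\<^sup>2 - (norm ?c)\<^sup>2"
    by (simp only: of_real_eq_iff)
  then have "(norm ?c)\<^sup>2 \<le> (norm x)\<^sup>2"
    by (metis diff_ge_0_iff_ge zero_le_power2)
  then show ?thesis
    by (rule power2_le_imp_le) simp
qed

text \<open>This is the orthogonal projection onto the line through \<open>u\<close>; Bessel's
  inequality bounds it by 1.\<close>

lemma rank_one_operator:
  assumes "norm u = 1"
  obtains R where "R \<in> bounded_ops smul smul" "\<And>x. blinfun_apply R x = smul (ip x u) u"
proof -
  have "bounded_linear (\<lambda>x. smul (ip x u) u)"
  proof (rule bounded_linear_intro[where K = 1])
    show "smul (ip (r *\<^sub>R x) u) u = r *\<^sub>R smul (ip x u) u" for r x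
      by (metis ip_scale_left scale_of_real scale_scale)
    show "norm (smul (ip x u) u) \<le> norm x * 1" for x
      using norm_ip_unit_le[OF assms] by (simp add: norm_smul assms)
  qed (simp add: ip_add_left scale_left_distrib)
  then have "blinfun_apply (Blinfun (\<lambda>x. smul (ip x u) u)) x = smul (ip x u) u" for x
    by (simp add: bounded_linear_Blinfun_apply)
  then show thesis
    by (intro that[of "Blinfun (\<lambda>x. smul (ip x u) u)"]) (auto simp: bounded_ops_def ip_scale_left)
qed

text \<open>Induction in the style of Gram-Schmidt: each new vector contributes a rank-one
  correction in the direction of the part that the operator built so far misses.\<close>

lemma finite_rank_operator_fixing:
  assumes "finite X"
  shows "\<exists>Q \<in> bounded_ops smul smul. (\<forall>x\<in>X. blinfun_apply Q x = x) \<and> range (blinfun_apply Q) \<subseteq> span X"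
  using assms
proof induction
  case empty
  show ?case
    by (rule bexI[of _ 0]) (auto simp: bounded_ops_zero[OF vector_space_axioms])
next
  case (insert x X)
  then obtain Q where Q: "Q \<in> bounded_ops smul smul" "\<And>y. y \<in> X \<Longrightarrow> blinfun_apply Q y = y"
      "range (blinfun_apply Q) \<subseteq> span X"
    by blast
  have sub: "blinfun_apply Q y \<in> span (insert x X)" for y
    using Q(3) span_mono[of X "insert x X"] by auto
  define v where "v = x - blinfun_apply Q x"
  show ?case
  proof (cases "v = 0")
    case True
    then show ?thesis
      using Q sub by (intro bexI[of _ Q]) (auto simp: v_def)
  next
    case False
    define u where "u = smul (of_real (inverse (norm v))) v"
    have u: "norm u = 1"
      using False by (simp add: u_def norm_smul del: of_real_inverse)
    have v: "smul (ip v u) u = v"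
    proof -
      have "v = smul (of_real (norm v)) u"
        using False by (simp add: u_def flip: of_real_mult)
      then show ?thesis
        using ip_self[of u] u by (metis ip_scale_left mult.right_neutral of_real_1 one_power2)
    qed
    obtain R where R: "R \<in> bounded_ops smul smul" "\<And>y. blinfun_apply R y = smul (ip y u) u"
      using rank_one_operator[OF u] by blast
    have "v \<in> span (insert x X)"
      unfolding v_def by (intro span_diff sub span_base) simp
    then have us: "u \<in> span (insert x X)"
      unfolding u_def by (rule span_scale)
    \<comment> \<open>The correction vanishes on \<open>X\<close>, where \<open>Q\<close> acts as
      the identity, and at \<open>x\<close> it adds \<open>R v = v\<close>, the missing
      part.\<close>
    let ?Q = "Q + (R o\<^sub>L (id_blinfun - Q))"
    have "?Q \<in> bounded_ops smul smul"
      by (intro bounded_ops_add bounded_ops_compose[where sK = smul] bounded_ops_diff bounded_ops_id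
          vector_space_axioms Q(1) R(1))
    moreover have "blinfun_apply ?Q x = x"
      using v by (simp add: blinfun.add_left blinfun.diff_left R(2) flip: v_def) (simp add: v_def)
    moreover have "blinfun_apply ?Q y = y" if "y \<in> X" for y
      using Q(2)[OF that] by (simp add: blinfun.add_left blinfun.diff_left)
    moreover have "blinfun_apply ?Q y \<in> span (insert x X)" for y
      by (simp add: blinfun.add_left R(2) span_add span_scale sub us)
    ultimately show ?thesis
      by (intro bexI[of _ ?Q]) auto
  qed
qed

section \<open>Orthogonal projections with a prescribed range\<close>

lemma orth_projection_onto_fixes:
  assumes "orth_projection_onto smul ip M P" "x \<in> M"
  shows "blinfun_apply P x = x"
proof -
  obtain y where "x = blinfun_apply P y"
    using assms by (auto simp: orth_projection_onto_def)
  moreover have "blinfun_apply (P o\<^sub>L P) y = blinfun_apply P y"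
    using assms by (simp add: orth_projection_onto_def)
  ultimately show ?thesis
    by simp
qed

text \<open>Each projection fixes the range of the other, so self-adjointness gives
  \<open>ip (P x) y = ip (P x) (P' y) = ip x (P' y) = ip (P' x) y\<close>.\<close>

lemma orth_projection_onto_unique:
  assumes P: "orth_projection_onto smul ip M P" and P': "orth_projection_onto smul ip M P'"
  shows "P = P'"
proof (rule blinfun_eqI)
  fix x
  have adj: "ip (blinfun_apply P a) b = ip a (blinfun_apply P b)"
    "ip (blinfun_apply P' a) b = ip a (blinfun_apply P' b)" for a b
    using P P' by (simp_all add: orth_projection_onto_def)
  have "blinfun_apply P a \<in> M" "blinfun_apply P' a \<in> M" for a
    using P P' by (auto simp: orth_projection_onto_def)
  then have "ip (blinfun_apply P x) y = ip (blinfun_apply P' x) y" for y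
    by (metis adj orth_projection_onto_fixes[OF P] orth_projection_onto_fixes[OF P'])
  then have "ip (blinfun_apply P x - blinfun_apply P' x) (blinfun_apply P x - blinfun_apply P' x) = 0"
    by (simp add: ip_diff_left)
  then show "blinfun_apply P x = blinfun_apply P' x"
    by (simp add: ip_self_eq_0)
qed

text \<open>\<open>orth_proj\<close> is a definite description, so existence and uniqueness are both
  due: \<open>P z\<close> lies in the double complement of \<open>N\<close>, and the difference of
  two candidates is orthogonal to itself.\<close>

lemma orth_proj_orth_complement:
  assumes "orth_projection_onto smul ip N P"
  shows "orth_proj ip (orth_complement ip N) z = z - blinfun_apply P z"
  unfolding orth_proj_def
proof (rule the_equality)
  have adj: "ip (blinfun_apply P a) b = ip a (blinfun_apply P b)" for a b
    using assms by (simp add: orth_projection_onto_def)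
  have PN: "blinfun_apply P z \<in> N"
    using assms by (auto simp: orth_projection_onto_def)
  have "z - blinfun_apply P z \<in> orth_complement ip N"
    using orth_projection_onto_fixes[OF assms] by (auto simp: orth_complement_def ip_diff_left adj)
  moreover have "blinfun_apply P z \<in> orth_complement ip (orth_complement ip N)"
    unfolding orth_complement_def
  proof (intro CollectI ballI)
    fix m assume "m \<in> {x. \<forall>m\<in>N. ip x m = 0}"
    then have "ip m (blinfun_apply P z) = 0"
      using PN by simp
    \<comment> \<open>Symmetry of orthogonality amounts to \<open>scalar_cnj 0 = 0\<close>, which
      \<open>ip_commute\<close> yields at zero vectors.\<close>
    then show "ip (blinfun_apply P z) m = 0"
      by (metis ip_commute ip_scale_left mult_zero_left scale_zero_left)
  qed
  ultimately show *: "z - blinfun_apply P z \<in> orth_complement ip N \<and>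
      z - (z - blinfun_apply P z) \<in> orth_complement ip (orth_complement ip N)"
    by simp
  fix p
  assume p: "p \<in> orth_complement ip N \<and> z - p \<in> orth_complement ip (orth_complement ip N)"
  let ?d = "p - (z - blinfun_apply P z)"
  have d: "?d \<in> orth_complement ip N"
    using p * by (auto simp: orth_complement_def ip_diff_left)
  have "ip (z - p) ?d = 0" "ip (z - (z - blinfun_apply P z)) ?d = 0"
    using p * d unfolding orth_complement_def[of ip "orth_complement ip N"] by blast+
  then have "ip ((z - (z - blinfun_apply P z)) - (z - p)) ?d = 0"
    by (metis diff_self ip_diff_left)
  then have "ip ?d ?d = 0"
    by (simp add: algebra_simps)
  then show "p = z - blinfun_apply P z"
    by (simp only: ip_self_eq_0 right_minus_eq)
qed

end

text \<open>The inclusion \<open>R(C) \<subseteq> R(D)\<close>.\<close>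

lemma complementable_ops_range_subset:
  assumes "hilbert_space scaleH ipH" "hilbert_space scaleK ipK"
    and S: "S \<in> complementable_ops scaleH ipH scaleK ipK M N"
    and P: "orth_projection_onto scaleH ipH M P" and L: "orth_projection_onto scaleK ipK N L"
    and "x \<in> M"
  shows "\<exists>y. blinfun_apply P y = 0 \<and>
    blinfun_apply S x - blinfun_apply L (blinfun_apply S x) = blinfun_apply S y - blinfun_apply L (blinfun_apply S y)"
proof -
  obtain P' L' R where P': "orth_projection_onto scaleH ipH M P'"
    and L': "orth_projection_onto scaleK ipK N L'"
    and R: "(id_blinfun - P') o\<^sub>L R = R"
      "(id_blinfun - L') o\<^sub>L S o\<^sub>L R = (id_blinfun - L') o\<^sub>L S"
    using S unfolding complementable_ops_def by blast
  \<comment> \<open>By uniqueness the projections from the definition are \<open>P\<close> and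
    \<open>L\<close>. The witness is then \<open>R x\<close>: the first identity puts it into the
    kernel of \<open>P\<close>, the second says that \<open>S\<close> sends it and \<open>x\<close>
    to vectors with the same \<open>N\<^sup>\<bottom>\<close>-component.\<close>
  have eq: "P' = P" "L' = L"
    using hilbert_space.orth_projection_onto_unique assms(1,2) P P' L L' by blast+
  have "blinfun_apply ((id_blinfun - P) o\<^sub>L R) x = blinfun_apply R x"
    using R(1) eq by simp
  then have "blinfun_apply P (blinfun_apply R x) = 0"
    by (simp add: blinfun.diff_left)
  moreover have "blinfun_apply ((id_blinfun - L) o\<^sub>L S o\<^sub>L R) x = blinfun_apply ((id_blinfun - L) o\<^sub>L S) x"
    using R(2) eq by simp
  then have "blinfun_apply S x - blinfun_apply L (blinfun_apply S x) =
      blinfun_apply S (blinfun_apply R x) - blinfun_apply L (blinfun_apply S (blinfun_apply R x))"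
    by (simp add: blinfun.diff_left)
  ultimately show ?thesis
    by blast
qed

theorem theorem3p12:
  fixes scaleH :: "'k::real_or_complex \<Rightarrow> 'a::banach \<Rightarrow> 'a"
    and ipH :: "'a \<Rightarrow> 'a \<Rightarrow> 'k"
    and scaleK :: "'k \<Rightarrow> 'b::banach \<Rightarrow> 'b"
    and ipK :: "'b \<Rightarrow> 'b \<Rightarrow> 'k"
    and M :: "'a set" and N :: "'b set"
    and T :: "'a \<Rightarrow>\<^sub>L 'b" and C :: "'a \<Rightarrow> 'b"
  assumes "hilbert_space scaleH ipH" and "hilbert_space scaleK ipK"
    and "closed_subspace scaleH M" and "closed_subspace scaleK N"
    and "T \<in> complementable_ops scaleH ipH scaleK ipK M N"
    and "C = block ipK M (orth_complement ipK N) T"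
    and "infinite_dimensional scaleK (C ` M)"
  shows "T \<in> (sot_bounded_ops scaleH scaleK) frontier_of
           (bounded_ops scaleH scaleK - complementable_ops scaleH ipH scaleK ipK M N)"
proof -
  interpret H: hilbert_space scaleH ipH by fact
  interpret K: hilbert_space scaleK ipK by fact
  let ?\<psi> = "complementable_ops scaleH ipH scaleK ipK M N"
  let ?\<tau> = "sot_bounded_ops scaleH scaleK"
  obtain P L where P: "orth_projection_onto scaleH ipH M P"
    and L: "orth_projection_onto scaleK ipK N L" and T: "T \<in> bounded_ops scaleH scaleK"
    using assms(5) unfolding complementable_ops_def by blast
  have PB: "P \<in> bounded_ops scaleH scaleH" and LB: "L \<in> bounded_ops scaleK scaleK"
    using P L by (auto simp: orth_projection_onto_def)
  \<comment> \<open>\<open>G\<close> restricts to the block \<open>C\<close> on \<open>M\<close> and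
    to the block \<open>D\<close> on \<open>M\<^sup>\<bottom>\<close>.\<close>
  define G where "G = (id_blinfun - L) o\<^sub>L T"
  have G: "blinfun_apply G x = blinfun_apply T x - blinfun_apply L (blinfun_apply T x)" for x
    by (simp add: G_def blinfun.diff_left)
  have "G \<in> bounded_ops scaleH scaleK"
    unfolding G_def
    by (rule bounded_ops_compose[OF bounded_ops_diff[OF K.vector_space_axioms bounded_ops_id LB] T])
  then interpret G: module_hom scaleH scaleK "blinfun_apply G"
    by (intro bounded_ops_module_hom H.vector_space_axioms K.vector_space_axioms)
  have CM: "C ` M = blinfun_apply G ` M"
    by (simp add: assms(6) block_def K.orth_proj_orth_complement[OF L] G)
  have "K.subspace (C ` M)"
    using assms(3) unfolding CM closed_subspace_def by (intro G.subspace_image) simp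
  then have not_sub: "\<not> C ` M \<subseteq> K.span X" if "finite X" for X
    using K.infinite_dimensional_not_in_finite_span assms(7) that by blast
  have "\<exists>S. S \<in> bounded_ops scaleH scaleK - ?\<psi> \<and> S \<in> U" if U: "T \<in> U" "openin ?\<tau> U" for U
  proof -
    obtain V where V: "openin strong_operator_topology V" "U = V \<inter> bounded_ops scaleH scaleK"
      using U(2) unfolding sot_bounded_ops_def openin_subtopology by blast
    then obtain X where X: "finite X"
      "\<And>S. (\<And>x. x \<in> X \<Longrightarrow> blinfun_apply S x = blinfun_apply T x) \<Longrightarrow> S \<in> V"
      using openin_strong_operator_topology_finite U(1) by (metis IntD1)
    let ?Y = "(\<lambda>x. x - blinfun_apply P x) ` X"
    obtain Q where Q: "Q \<in> bounded_ops scaleH scaleH" "\<And>y. y \<in> ?Y \<Longrightarrow> blinfun_apply Q y = y"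
      "range (blinfun_apply Q) \<subseteq> H.span ?Y"
      using H.finite_rank_operator_fixing[of ?Y] X(1) by blast
    define S where "S = T o\<^sub>L (P + (Q o\<^sub>L (id_blinfun - P)))"
    have S: "blinfun_apply S x = blinfun_apply T (blinfun_apply P x + blinfun_apply Q (x - blinfun_apply P x))" for x
      by (simp add: S_def blinfun.diff_left blinfun.add_left)
    have "S \<in> bounded_ops scaleH scaleK"
      unfolding S_def
      by (intro bounded_ops_add bounded_ops_compose[where sK = scaleH] bounded_ops_diff bounded_ops_id
          H.vector_space_axioms T PB Q(1))
    moreover have "S \<in> V"
      using Q(2) by (intro X(2)) (simp add: S)
    moreover have "S \<notin> ?\<psi>"
    proof
      assume "S \<in> ?\<psi>"
      note sub = complementable_ops_range_subset[OF assms(1,2) this P L]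
      \<comment> \<open>The factor \<open>P + Q (1 - P)\<close> of \<open>S\<close> is the identity
        on \<open>M\<close>, which keeps \<open>C\<close>, and equals \<open>Q\<close> on the kernel
        of \<open>P\<close>, so there the \<open>N\<^sup>\<bottom>\<close>-components of values of
        \<open>S\<close> are images under \<open>G\<close> of vectors in the span of
        \<open>?Y\<close>.\<close>
      have "C ` M \<subseteq> K.span (blinfun_apply G ` ?Y)"
      proof
        fix z assume "z \<in> C ` M"
        then obtain m where m: "m \<in> M" "z = blinfun_apply G m"
          using CM by blast
        then have "blinfun_apply S m = blinfun_apply T m"
          by (simp add: S H.orth_projection_onto_fixes[OF P])
        moreover obtain y where y: "blinfun_apply P y = 0"
          "blinfun_apply S m - blinfun_apply L (blinfun_apply S m) =
            blinfun_apply S y - blinfun_apply L (blinfun_apply S y)"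
          using sub[OF m(1)] by blast
        ultimately have "blinfun_apply G m = blinfun_apply S y - blinfun_apply L (blinfun_apply S y)"
          by (simp only: G)
        then have "z = blinfun_apply G (blinfun_apply Q y)"
          using y(1) by (simp add: m(2) S G)
        then show "z \<in> K.span (blinfun_apply G ` ?Y)"
          using Q(3) by (auto simp: G.span_image)
      qed
      then show False
        using not_sub[of "blinfun_apply G ` ?Y"] X(1) by simp
    qed
    ultimately show ?thesis
      using V(2) by blast
  qed
  moreover have "topspace ?\<tau> = bounded_ops scaleH scaleK"
    by (simp add: sot_bounded_ops_def strong_operator_topology_topspace)
  ultimately have "T \<in> ?\<tau> closure_of (bounded_ops scaleH scaleK - ?\<psi>)"
    unfolding in_closure_of using T by (intro conjI allI impI) simp_all
  \<comment> \<open>Being complementable, \<open>T\<close> is outside the set itself and hence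
    outside its interior.\<close>
  moreover have "T \<notin> ?\<tau> interior_of (bounded_ops scaleH scaleK - ?\<psi>)"
    using subsetD[OF interior_of_subset[of ?\<tau> "bounded_ops scaleH scaleK - ?\<psi>"], of T] assms(5)
    by (metis DiffD2)
  ultimately show ?thesis
    by (simp add: frontier_of_def)
qed

end
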